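(* Let $G$ be a finite, simple, connected, undirected graph. Then the Lovász complex $\mathsf{L}(G)$ and the halved doubled Lovász complex $\mathsf{HDL}(G)$ are $\mathbb{Z}_2$-isomorphic, i.e. there is an isomorphism of simplicial complexes $\mathsf{L}(G)\to\mathsf{HDL}(G)$ that commutes with the simplicial $\mathbb{Z}_2$-actions.
   Context: $V(G)$ is the node set of $G$. For $A\subseteq V(G)$, $\mathrm{CN}(A)$ is the set of all nodes adjacent to every $a\in A$, with $\mathrm{CN}(\emptyset)=V(G)$; $\mathrm{CN}^2(A)=\mathrm{CN}(\mathrm{CN}(A))$. The neighborhood complex $\mathsf{N}(G)$ is the abstract simplicial complex whose simplices are the sets $A\subseteq V(G)$ with $\mathrm{CN}(A)\ne\emptyset$. A chain $\mathcal{A}$ is a (possibly empty) family $A_1\subset\dots\subset A_p$ of strictly increasing subsets of $V(G)$. For sets $A,B$ put $A\uplus B:=\{(a,0):a\in A\}\cup\{(b,1):b\in B\}$. Lovász complex: $\mathsf{L}(G)$ is the subcomplex of the barycentric subdivision $\mathrm{sd}(\mathsf{N}(G))$ induced by the fixed points of $\mathrm{CN}^2$. That is, its vertices are the nonempty sets $A\subseteq V(G)$ with $\mathrm{CN}(A)\ne\emptyset$ and $\mathrm{CN}^2(A)=A$, and its simplices are the chains of such sets. Its free simplicial $\mathbb{Z}_2$-action is $A\mapsto\mathrm{CN}(A)$ on vertices. Box complex: $\mathsf{B}(G):=\{A\uplus B: A,B\in\mathsf{N}(G),\ A\subseteq\mathrm{CN}(B),\ B\subseteq\mathrm{CN}(A)\}$,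 with the $\mathbb{Z}_2$-action $A\uplus B\mapsto B\uplus A$. Its two shores are the subcomplexes induced by the vertices $(v,0)$ and by the vertices $(v,1)$, respectively. Shore subdivision: $\mathrm{ssd}(\mathsf{B}(G))$ is the simplicial complex consisting of the simplices of the joins $\mathrm{sd}(\sigma\cap K_1)*\mathrm{sd}(\sigma\cap K_2)$, $\sigma\in\mathsf{B}(G)$, where $K_1,K_2$ are the two shores. Explicitly: its vertices are denoted $A\uplus\emptyset$ (first shore) and $\emptyset\uplus A$ (second shore), for $\emptyset\neq A\subseteq V(G)$ with $\mathrm{CN}(A)\neq\emptyset$. Its simplices are denoted $\mathcal{A}\uplus\mathcal{B}$, spanned by the vertices $A\uplus\emptyset$ ($A\in\mathcal{A}$) and $\emptyset\uplus B$ ($B\in\mathcal{B}$), where $\mathcal{A},\mathcal{B}$ are chains of such sets with $A\subseteq\mathrm{CN}(B)$ for all $A\in\mathcal{A}$, $B\in\mathcal{B}$. Its $\mathbb{Z}_2$-action interchanges $A\uplus\emptyset$ and $\emptyset\uplus A$. Doubled Lovász complex: $\mathsf{DL}(G)$ is the image of the simplicial $\mathbb{Z}_2$-map $\mathrm{ssd}(\mathsf{B}(G))\to\mathrm{ssd}(\mathsf{B}(G))$ given on vertices by $A\uplus\emptyset\mapsto\mathrm{CN}^2(A)\uplus\emptyset$ and $\emptyset\uplus A\mapsto\emptyset\uplus\mathrm{CN}^2(A)$. Explicitly, $\mathsf{DL}(G)$ consists of all $\mathcal{A}\uplus\mathcal{B}$ with $\mathcal{A},\mathcal{B}\in\mathsf{L}(G)$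 (possibly empty) such that every $a\in A$ is adjacent to every $b\in B$ for all $A\in\mathcal{A}$, $B\in\mathcal{B}$. Halved doubled Lovász complex: fix a linear order on $V(G)$ and define a linear order $\prec$ on the vertices of $\mathsf{L}(G)$ by $A\prec B$ iff $|A|<|B|$, or $|A|=|B|$ and $A<_{\mathrm{lex}}B$ (lexicographic order). The vertices of $\mathsf{DL}(G)$ are partitioned into pairs $\{A\uplus\emptyset,\ \emptyset\uplus\mathrm{CN}(A)\}$, and each pair is ordered by: $A\uplus\emptyset\prec\emptyset\uplus\mathrm{CN}(A)$ iff $A\prec\mathrm{CN}(A)$ (otherwise $\emptyset\uplus\mathrm{CN}(A)$ is the smaller one). Define the simplicial $\mathbb{Z}_2$-map $j:\mathsf{DL}(G)\to\mathsf{DL}(G)$ on vertices by $j(A\uplus\emptyset)=\min_\prec\{A\uplus\emptyset,\emptyset\uplus\mathrm{CN}(A)\}$ and $j(\emptyset\uplus B)=\min_\prec\{\emptyset\uplus B,\mathrm{CN}(B)\uplus\emptyset\}$. Then $\mathsf{HDL}(G):=\operatorname{im} j=\{j(\sigma):\sigma\in\mathsf{DL}(G)\}$, with the $\mathbb{Z}_2$-action inherited from $\mathsf{DL}(G)\subseteq\mathrm{ssd}(\mathsf{B}(G))$, interchanging $A\uplus\emptyset$ and $\emptyset\uplus A$. *)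

theory Defs
  imports "Graph_Theory.Digraph_Component"
begin

section \<open>Abstract simplicial complexes\<close>

text \<open>An abstract simplicial complex is given by its set of simplices, the empty
  simplex included; its vertex set is the union of all simplices.\<close>

type_synonym 'v complex = "'v set set"

definition is_complex :: "'v complex \<Rightarrow> bool" where
  "is_complex K \<longleftrightarrow> (\<forall>\<sigma>\<in>K. finite \<sigma> \<and> (\<forall>\<tau>. \<tau> \<subseteq> \<sigma> \<longrightarrow> \<tau> \<in> K))"

definition sd :: "'v complex \<Rightarrow> 'v set complex" where
  "sd K = {C. finite C \<and> C \<subseteq> K - {{}} \<and> chain\<^sub>\<subseteq> C}"

definition join :: "'v complex \<Rightarrow> 'w complex \<Rightarrow> ('v + 'w) complex" where
  "join K L = {\<sigma> <+> \<tau> | \<sigma> \<tau>. \<sigma> \<in> K \<and> \<tau> \<in> L}"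

definition image_complex :: "('v \<Rightarrow> 'w) \<Rightarrow> 'v complex \<Rightarrow> 'w complex" where
  "image_complex f K = {f ` \<sigma> | \<sigma>. \<sigma> \<in> K}"

definition simplicial_iso :: "'v complex \<Rightarrow> 'w complex \<Rightarrow> ('v \<Rightarrow> 'w) \<Rightarrow> bool" where
  "simplicial_iso K L f \<longleftrightarrow>
     bij_betw f (\<Union>K) (\<Union>L) \<and> (\<forall>\<sigma>. \<sigma> \<subseteq> \<Union>K \<longrightarrow> (\<sigma> \<in> K \<longleftrightarrow> f ` \<sigma> \<in> L))"

text \<open>A simplicial \<open>\<int>\<^sub>2\<close>-action is given by the vertex map of its generator.\<close>

definition Z2_action :: "'v complex \<Rightarrow> ('v \<Rightarrow> 'v) \<Rightarrow> bool" where
  "Z2_action K \<nu> \<longleftrightarrow> (\<forall>v\<in>\<Union>K. \<nu> (\<nu> v) = v) \<and> (\<forall>\<sigma>\<in>K. \<nu> ` \<sigma> \<in> K)"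

definition Z2_isomorphic ::
  "'v complex \<Rightarrow> ('v \<Rightarrow> 'v) \<Rightarrow> 'w complex \<Rightarrow> ('w \<Rightarrow> 'w) \<Rightarrow> bool" where
  "Z2_isomorphic K \<nu> L \<mu> \<longleftrightarrow>
     (\<exists>f. simplicial_iso K L f \<and> (\<forall>v\<in>\<Union>K. f (\<nu> v) = \<mu> (f v)))"

section \<open>Complexes of a graph\<close>

definition CN :: "('a, 'b) pre_digraph \<Rightarrow> 'a set \<Rightarrow> 'a set" where
  "CN G A = {v \<in> verts G. \<forall>a\<in>A. v \<rightarrow>\<^bsub>G\<^esub> a}"

abbreviation CN2 :: "('a, 'b) pre_digraph \<Rightarrow> 'a set \<Rightarrow> 'a set" where
  "CN2 G A \<equiv> CN G (CN G A)"

definition neighborhood_complex :: "('a, 'b) pre_digraph \<Rightarrow> 'a complex" where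
  "neighborhood_complex G = {A. A \<subseteq> verts G \<and> CN G A \<noteq> {}}"

definition lovasz_complex :: "('a, 'b) pre_digraph \<Rightarrow> 'a set complex" where
  "lovasz_complex G = {C \<in> sd (neighborhood_complex G). \<forall>A\<in>C. CN2 G A = A}"

text \<open>The disjoint union \<open>A \<uplus> B\<close> is \<open>A <+> B\<close>: the tags 0 and 1 are \<open>Inl\<close> and \<open>Inr\<close>.\<close>

definition box_complex :: "('a, 'b) pre_digraph \<Rightarrow> ('a + 'a) complex" where
  "box_complex G = {A <+> B | A B. A \<in> neighborhood_complex G \<and> B \<in> neighborhood_complex G \<and>
     A \<subseteq> CN G B \<and> B \<subseteq> CN G A}"

text \<open>The faces of \<open>\<sigma>\<close> in the two shores are represented by \<open>Inl -` \<sigma>\<close> and \<open>Inr -` \<sigma>\<close>;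
  the tag naming the shore is restored by the join. So the vertices \<open>A \<uplus> \<emptyset>\<close> and
  \<open>\<emptyset> \<uplus> A\<close> of the shore subdivision are \<open>Inl A\<close> and \<open>Inr A\<close>.\<close>

definition ssd :: "('a + 'a) complex \<Rightarrow> ('a set + 'a set) complex" where
  "ssd K = (\<Union>\<sigma>\<in>K. join (sd (Pow (Inl -` \<sigma>))) (sd (Pow (Inr -` \<sigma>))))"

fun swap_shores :: "'v + 'v \<Rightarrow> 'v + 'v" where
  "swap_shores (Inl A) = Inr A"
| "swap_shores (Inr A) = Inl A"

definition doubled_lovasz_complex :: "('a, 'b) pre_digraph \<Rightarrow> ('a set + 'a set) complex" where
  "doubled_lovasz_complex G = image_complex (map_sum (CN2 G) (CN2 G)) (ssd (box_complex G))"

text \<open>The linear order on the nodes is a reflexive relation \<open>r\<close>. Sets are compared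
  lexicographically through the lists of their elements in increasing order.\<close>

definition increasing_list :: "'a rel \<Rightarrow> 'a set \<Rightarrow> 'a list" where
  "increasing_list r A = (THE xs. set xs = A \<and> sorted_wrt (\<lambda>x y. (x, y) \<in> r - Id) xs)"

definition set_prec :: "'a rel \<Rightarrow> 'a set \<Rightarrow> 'a set \<Rightarrow> bool" where
  "set_prec r A B \<longleftrightarrow> card A < card B \<or>
     card A = card B \<and> (increasing_list r A, increasing_list r B) \<in> lexord (r - Id)"

text \<open>The smaller element of the pair \<open>{A \<uplus> \<emptyset>, \<emptyset> \<uplus> CN(A)}\<close>.\<close>

definition pair_min :: "('a, 'b) pre_digraph \<Rightarrow> 'a rel \<Rightarrow> 'a set \<Rightarrow> 'a set + 'a set" where
  "pair_min G r A = (if set_prec r A (CN G A) then Inl A else Inr (CN G A))"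

text \<open>On the vertices of the doubled Lovasz complex, \<open>CN(CN(B)) = B\<close>, so the pair
  containing \<open>\<emptyset> \<uplus> B\<close> is the one of \<open>A = CN(B)\<close>.\<close>

fun halving_map :: "('a, 'b) pre_digraph \<Rightarrow> 'a rel \<Rightarrow> 'a set + 'a set \<Rightarrow> 'a set + 'a set" where
  "halving_map G r (Inl A) = pair_min G r A"
| "halving_map G r (Inr B) = pair_min G r (CN G B)"

definition halved_doubled_lovasz_complex ::
  "('a, 'b) pre_digraph \<Rightarrow> 'a rel \<Rightarrow> ('a set + 'a set) complex" where
  "halved_doubled_lovasz_complex G r =
     image_complex (halving_map G r) (doubled_lovasz_complex G)"

section \<open>Explicit descriptions\<close>

lemma CN_subset: "CN G A \<subseteq> verts G"
  by (auto simp: CN_def)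

lemma CN_antimono: "A \<subseteq> B \<Longrightarrow> CN G B \<subseteq> CN G A"
  by (auto simp: CN_def)

lemma connected_nonempty: "connected G \<Longrightarrow> verts G \<noteq> {}"
  by (auto simp: connected_def strongly_connected_def)

lemma vimage_Plus: "Inl -` (A <+> B) = A" "Inr -` (A <+> B) = B"
  by auto

lemma image_Plus: "map_sum f g ` (A <+> B) = f ` A <+> g ` B"
  by (force simp: Plus_def)

lemma Plus_inject: "A <+> B = C <+> D \<longleftrightarrow> A = C \<and> B = D"
  by (metis vimage_Plus)

lemma swap_shores_Plus: "swap_shores ` (A <+> B) = B <+> A"
  by (force simp: Plus_def)

lemma increasing_list_ex1:
  assumes lin: "linear_order_on V r" and A: "finite A" "A \<subseteq> V"
  shows "\<exists>!xs. set xs = A \<and> sorted_wrt (\<lambda>x y. (x, y) \<in> r - Id) xs"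
proof -
  let ?lt = "\<lambda>x y. (x, y) \<in> r - Id"
  have tr: "trans r" and asy: "antisym r" and tot: "total_on V r"
    using lin by (auto simp: linear_order_on_def partial_order_on_def preorder_on_def)
  have ex: "\<exists>xs. set xs = A \<and> sorted_wrt ?lt xs"
    using A
  proof (induction A rule: finite_induct)
    case empty
    then show ?case by (intro exI[of _ "[]"]) simp
  next
    case (insert x A)
    then obtain xs where xs: "set xs = A" "sorted_wrt ?lt xs" by auto
    let ?ys = "filter (\<lambda>y. ?lt y x) xs @ x # filter (\<lambda>y. ?lt x y) xs"
    have "set ?ys = insert x A"
      using xs(1) insert.hyps insert.prems tot by (auto simp: total_on_def)
    moreover have "sorted_wrt ?lt ?ys"
      using xs(2) transD[OF tr] antisymD[OF asy]
      by (fastforce simp: sorted_wrt_append sorted_wrt_filter)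
    ultimately show ?case by (intro exI[of _ ?ys]) (rule conjI)
  qed
  have uniq: "xs = ys" if "sorted_wrt ?lt xs" "sorted_wrt ?lt ys" "set xs = set ys" for xs ys
    using that
  proof (induction xs arbitrary: ys)
    case Nil
    then show ?case by simp
  next
    case (Cons x xs)
    then obtain y zs where ys: "ys = y # zs" by (cases ys) auto
    have x: "\<And>z. z \<in> set xs \<Longrightarrow> ?lt x z" and y: "\<And>z. z \<in> set zs \<Longrightarrow> ?lt y z"
      using Cons.prems ys by simp_all
    have "x \<in> insert y (set zs)" "y \<in> insert x (set xs)"
      using Cons.prems(3) unfolding ys by auto
    then have xy: "x = y" using x[of y] y[of x] antisymD[OF asy, of x y] by auto
    moreover have "x \<notin> set xs" "x \<notin> set zs" using x[of x] y[of x] xy by auto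
    then have "set xs = set zs" using Cons.prems(3) xy unfolding ys by auto
    ultimately show ?case using Cons.IH[of zs] Cons.prems ys by simp
  qed
  show ?thesis using ex uniq by metis
qed

lemma increasing_list:
  assumes "linear_order_on V r" "finite A" "A \<subseteq> V"
  shows "set (increasing_list r A) = A" "distinct (increasing_list r A)"
proof -
  let ?xs = "increasing_list r A"
  have *: "set ?xs = A \<and> sorted_wrt (\<lambda>x y. (x, y) \<in> r - Id) ?xs"
    unfolding increasing_list_def by (rule theI'[OF increasing_list_ex1[OF assms]])
  then show "set ?xs = A" by simp
  have "distinct xs" if "sorted_wrt (\<lambda>x y. (x, y) \<in> r - Id) xs" for xs
    using that by (induction xs) auto
  then show "distinct ?xs" using * by blast
qed

lemma lexord_trichotomy:
  assumes "total_on V s" "set xs \<subseteq> V" "set ys \<subseteq> V" "length xs = length ys" "xs \<noteq> ys"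
  shows "(xs, ys) \<in> lexord s \<or> (ys, xs) \<in> lexord s"
  using assms(4,2,3,5)
  by (induction xs ys rule: list_induct2) (use assms(1) in \<open>auto simp: total_on_def\<close>)

lemma set_prec_asym_total:
  assumes lin: "linear_order_on V r" and "finite A" "A \<subseteq> V" "finite B" "B \<subseteq> V" "A \<noteq> B"
  shows "set_prec r A B \<longleftrightarrow> \<not> set_prec r B A"
proof (cases "card A = card B")
  case False
  then show ?thesis by (auto simp: set_prec_def)
next
  case True
  let ?l = "increasing_list r"
  note A = increasing_list[OF lin assms(2,3)] and B = increasing_list[OF lin assms(4,5)]
  have len: "length (?l A) = length (?l B)"
    using True A B distinct_card by metis
  have "total_on V (r - Id)"
    using lin by (auto simp: linear_order_on_def total_on_def)
  moreover have "?l A \<noteq> ?l B" using A(1) B(1) \<open>A \<noteq> B\<close> by metis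
  ultimately have "(?l A, ?l B) \<in> lexord (r - Id) \<or> (?l B, ?l A) \<in> lexord (r - Id)"
    using len A(1) B(1) assms(3,5) by (intro lexord_trichotomy) simp_all
  moreover have "asym (r - Id)"
    using lin by (auto simp: linear_order_on_def partial_order_on_def asym_on_def antisym_def)
  then have "\<not> ((?l A, ?l B) \<in> lexord (r - Id) \<and> (?l B, ?l A) \<in> lexord (r - Id))"
    using lexord_asymmetric by blast
  ultimately show ?thesis using True by (auto simp: set_prec_def)
qed

context graph
begin

lemma CN_sym: "A \<subseteq> verts G \<Longrightarrow> B \<subseteq> CN G A \<Longrightarrow> A \<subseteq> CN G B"
  unfolding CN_def using sym_arcs by (fastforce simp: symmetric_def sym_def)

lemma CN2_extensive: "A \<subseteq> verts G \<Longrightarrow> A \<subseteq> CN2 G A"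
  by (rule CN_sym) auto

lemma CN_CN2: "A \<subseteq> verts G \<Longrightarrow> CN G (CN2 G A) = CN G A"
  using CN2_extensive[of A] CN2_extensive[OF CN_subset, of A] CN_antimono[of A "CN2 G A" G]
  by auto

lemma finite_neighborhood_complex: "finite (neighborhood_complex G)"
  by (rule finite_subset[of _ "Pow (verts G)"]) (auto simp: neighborhood_complex_def)

lemma sd_neighborhood_complex:
  "C \<in> sd (neighborhood_complex G) \<longleftrightarrow>
     (\<forall>A\<in>C. A \<noteq> {} \<and> A \<subseteq> verts G \<and> CN G A \<noteq> {}) \<and> chain\<^sub>\<subseteq> C"
proof -
  have "finite C" if "C \<subseteq> neighborhood_complex G - {{}}"
    using that finite_neighborhood_complex finite_subset by blast
  then show ?thesis
    unfolding sd_def neighborhood_complex_def by auto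
qed

lemma lovasz_complex_iff:
  "C \<in> lovasz_complex G \<longleftrightarrow>
     (\<forall>A\<in>C. A \<noteq> {} \<and> A \<subseteq> verts G \<and> CN G A \<noteq> {} \<and> CN2 G A = A) \<and> chain\<^sub>\<subseteq> C"
  unfolding lovasz_complex_def by (auto simp: sd_neighborhood_complex)

lemma Union_chain_in:
  assumes "finite C" "C \<noteq> {}" "chain\<^sub>\<subseteq> C" shows "\<Union>C \<in> C"
  using assms by (auto intro!: Union_in_chain simp: subset_chain_def chain_subset_def)

lemma ssd_box_complex_iff:
  assumes ne: "verts G \<noteq> {}"
  shows "\<A> <+> \<B> \<in> ssd (box_complex G) \<longleftrightarrow>
     \<A> \<in> sd (neighborhood_complex G) \<and> \<B> \<in> sd (neighborhood_complex G) \<and>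
     (\<forall>A\<in>\<A>. \<forall>B\<in>\<B>. A \<subseteq> CN G B)"
    (is "?l \<longleftrightarrow> ?r")
proof
  assume ?l
  then obtain A B where AB: "A \<in> neighborhood_complex G" "B \<in> neighborhood_complex G"
    "A \<subseteq> CN G B" "\<A> \<in> sd (Pow A)" "\<B> \<in> sd (Pow B)"
    unfolding ssd_def box_complex_def join_def
    by (auto simp: Plus_inject vimage_Plus)
  have "X \<in> neighborhood_complex G" if "X \<subseteq> Y" "Y \<in> neighborhood_complex G" for X Y
    using that CN_antimono[of X Y G] by (auto simp: neighborhood_complex_def)
  moreover have "X \<subseteq> CN G Y" if "X \<subseteq> A" "Y \<subseteq> B" for X Y
    using that AB(3) CN_antimono[of Y B G] by auto
  ultimately have sub: "X \<in> neighborhood_complex G" "Y \<in> neighborhood_complex G" "X \<subseteq> CN G Y"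
    if "X \<subseteq> A" "Y \<subseteq> B" for X Y
    using AB(1,2) that by simp_all
  have "\<A> \<subseteq> Pow A" "\<B> \<subseteq> Pow B" "{} \<notin> \<A>" "{} \<notin> \<B>"
    "finite \<A>" "finite \<B>" "chain\<^sub>\<subseteq> \<A>" "chain\<^sub>\<subseteq> \<B>"
    using AB(4,5) unfolding sd_def by auto
  moreover from this have "\<A> \<subseteq> neighborhood_complex G - {{}}" "\<B> \<subseteq> neighborhood_complex G - {{}}"
    using sub(1)[OF _ empty_subsetI] sub(2)[OF empty_subsetI] by auto
  moreover have "\<forall>X\<in>\<A>. \<forall>Y\<in>\<B>. X \<subseteq> CN G Y"
    using sub(3) \<open>\<A> \<subseteq> Pow A\<close> \<open>\<B> \<subseteq> Pow B\<close> by (meson PowD subset_iff)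
  ultimately show ?r unfolding sd_def by simp
next
  assume r: ?r
  let ?A = "\<Union>\<A>" and ?B = "\<Union>\<B>"
  have U: "\<Union>\<C> \<in> neighborhood_complex G" if "\<C> \<in> sd (neighborhood_complex G)" for \<C>
  proof (cases "\<C> = {}")
    case True
    then show ?thesis using ne by (auto simp: neighborhood_complex_def CN_def)
  next
    case False
    then have "\<Union>\<C> \<in> \<C>" using that Union_chain_in[of \<C>] by (simp add: sd_def)
    moreover have "\<C> \<subseteq> neighborhood_complex G" using that unfolding sd_def by blast
    ultimately show ?thesis by (rule rev_subsetD)
  qed
  have A: "?A \<in> neighborhood_complex G" and B: "?B \<in> neighborhood_complex G"
    using r by (simp_all add: U)
  have AB: "?A \<subseteq> CN G ?B"
  proof
    fix x assume x: "x \<in> ?A"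
    then obtain X where X: "X \<in> \<A>" "x \<in> X" by blast
    have "x \<rightarrow>\<^bsub>G\<^esub> b" if "b \<in> Y" "Y \<in> \<B>" for b Y
    proof -
      have "x \<in> CN G Y" using r X that by blast
      then show ?thesis using that unfolding CN_def by blast
    qed
    moreover have "x \<in> verts G" using x A unfolding neighborhood_complex_def by blast
    ultimately show "x \<in> CN G ?B" unfolding CN_def by blast
  qed
  have "?B \<subseteq> verts G" using B unfolding neighborhood_complex_def mem_Collect_eq by (rule conjunct1)
  then have "?B \<subseteq> CN G ?A" using AB by (rule CN_sym)
  then have box: "?A <+> ?B \<in> box_complex G"
    unfolding box_complex_def using A B AB
    by (intro CollectI exI[of _ ?A] exI[of _ ?B] conjI refl)
  have "\<A> \<in> sd (Pow ?A)" "\<B> \<in> sd (Pow ?B)"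
    using r by (auto simp: sd_def)
  then have "\<A> <+> \<B> \<in> join (sd (Pow (Inl -` (?A <+> ?B)))) (sd (Pow (Inr -` (?A <+> ?B))))"
    unfolding join_def vimage_Plus by (intro CollectI exI[of _ \<A>] exI[of _ \<B>] conjI refl)
  then show ?l
    unfolding ssd_def by (rule UN_I[OF box])
qed

lemma ssd_cases:
  assumes "\<sigma> \<in> ssd K" obtains \<A> \<B> where "\<sigma> = \<A> <+> \<B>"
  using assms by (auto simp: ssd_def join_def)

lemma doubled_lovasz_complex_eq:
  assumes ne: "verts G \<noteq> {}"
  shows "doubled_lovasz_complex G = {\<A> <+> \<B> | \<A> \<B>. \<A> \<in> lovasz_complex G \<and> \<B> \<in> lovasz_complex G \<and>
     (\<forall>A\<in>\<A>. \<forall>B\<in>\<B>. \<forall>a\<in>A. \<forall>b\<in>B. a \<rightarrow>\<^bsub>G\<^esub> b)}" (is "_ = ?R")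
proof (intro set_eqI iffI)
  fix \<sigma> assume "\<sigma> \<in> doubled_lovasz_complex G"
  then obtain \<A> \<B> where s: "\<sigma> = CN2 G ` \<A> <+> CN2 G ` \<B>" "\<A> <+> \<B> \<in> ssd (box_complex G)"
    unfolding doubled_lovasz_complex_def image_complex_def
    by (smt (verit) image_Plus mem_Collect_eq ssd_cases)
  then have AB: "\<A> \<in> sd (neighborhood_complex G)" "\<B> \<in> sd (neighborhood_complex G)"
    "\<And>A B. A \<in> \<A> \<Longrightarrow> B \<in> \<B> \<Longrightarrow> A \<subseteq> CN G B"
    using ssd_box_complex_iff[OF ne] by auto
  have L: "CN2 G ` \<C> \<in> lovasz_complex G" if C: "\<C> \<in> sd (neighborhood_complex G)" for \<C>
    unfolding lovasz_complex_iff
  proof (intro conjI ballI)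
    fix X assume "X \<in> CN2 G ` \<C>"
    then obtain Y where Y: "X = CN2 G Y" "Y \<noteq> {}" "Y \<subseteq> verts G" "CN G Y \<noteq> {}"
      using C by (auto simp: sd_neighborhood_complex)
    then show "X \<noteq> {}" "X \<subseteq> verts G" "CN G X \<noteq> {}" "CN2 G X = X"
      using CN2_extensive[of Y] CN_subset[of G] CN_CN2[of Y] by auto
  next
    show "chain\<^sub>\<subseteq> (CN2 G ` \<C>)"
    proof -
      have "CN2 G A \<subseteq> CN2 G B \<or> CN2 G B \<subseteq> CN2 G A" if "A \<in> \<C>" "B \<in> \<C>" for A B
      proof -
        have "A \<subseteq> B \<or> B \<subseteq> A"
          using C that unfolding sd_neighborhood_complex chain_subset_def by simp
        then show ?thesis
          using CN_antimono[OF CN_antimono, of A B G G] CN_antimono[OF CN_antimono, of B A G G]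
          by argo
      qed
      then show ?thesis unfolding chain_subset_def by blast
    qed
  qed
  have "a \<rightarrow>\<^bsub>G\<^esub> b" if "A \<in> \<A>" "B \<in> \<B>" "a \<in> CN2 G A" "b \<in> CN2 G B" for A B a b
  proof -
    have B: "B \<subseteq> verts G" using that AB by (auto simp: sd_neighborhood_complex)
    have "CN2 G A \<subseteq> CN2 G (CN G B)"
      using AB(3)[OF that(1,2)] by (intro CN_antimono)
    then have "a \<in> CN G (CN2 G B)" using that(3) by blast
    then show ?thesis using that(4) unfolding CN_def[of G "CN2 G B"] by blast
  qed
  then have "\<forall>A\<in>CN2 G ` \<A>. \<forall>B\<in>CN2 G ` \<B>. \<forall>a\<in>A. \<forall>b\<in>B. a \<rightarrow>\<^bsub>G\<^esub> b"
    by simp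
  then show "\<sigma> \<in> ?R" using L[OF AB(1)] L[OF AB(2)] s(1) by blast
next
  fix \<sigma> assume "\<sigma> \<in> ?R"
  then obtain \<A> \<B> where s: "\<sigma> = \<A> <+> \<B>" "\<A> \<in> lovasz_complex G" "\<B> \<in> lovasz_complex G"
    "\<forall>A\<in>\<A>. \<forall>B\<in>\<B>. \<forall>a\<in>A. \<forall>b\<in>B. a \<rightarrow>\<^bsub>G\<^esub> b" by blast
  have "CN2 G ` \<A> = \<A>" "CN2 G ` \<B> = \<B>"
    using s by (auto simp: lovasz_complex_iff image_iff)
  moreover have "\<A> <+> \<B> \<in> ssd (box_complex G)"
    unfolding ssd_box_complex_iff[OF ne]
  proof (intro conjI ballI subsetI)
    show "\<A> \<in> sd (neighborhood_complex G)" "\<B> \<in> sd (neighborhood_complex G)"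
      using s(2,3) unfolding lovasz_complex_def by simp_all
  next
    fix A B a assume "A \<in> \<A>" "B \<in> \<B>" "a \<in> A"
    moreover from this have "a \<in> verts G"
      using s(2) unfolding lovasz_complex_iff by blast
    ultimately show "a \<in> CN G B"
      using s(4) unfolding CN_def by simp
  qed
  ultimately show "\<sigma> \<in> doubled_lovasz_complex G"
    unfolding doubled_lovasz_complex_def image_complex_def s(1)
    by (intro CollectI exI[of _ "\<A> <+> \<B>"]) (simp add: image_Plus)
qed

lemma is_complex_lovasz: "is_complex (lovasz_complex G)"
  unfolding is_complex_def
proof (intro ballI conjI allI impI)
  fix \<sigma> assume s: "\<sigma> \<in> lovasz_complex G"
  then show "finite \<sigma>" by (simp add: lovasz_complex_def sd_def)
  fix \<tau> assume "\<tau> \<subseteq> \<sigma>"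
  then show "\<tau> \<in> lovasz_complex G"
    using s unfolding lovasz_complex_iff chain_subset_def by (meson subsetD)
qed

lemma Z2_action_lovasz: "Z2_action (lovasz_complex G) (CN G)"
  unfolding Z2_action_def
proof (intro conjI ballI)
  fix v assume "v \<in> \<Union>(lovasz_complex G)"
  then show "CN2 G v = v" by (auto simp: lovasz_complex_def)
next
  fix \<sigma> assume s: "\<sigma> \<in> lovasz_complex G"
  show "CN G ` \<sigma> \<in> lovasz_complex G"
    unfolding lovasz_complex_iff
  proof (intro conjI ballI)
    fix X assume "X \<in> CN G ` \<sigma>"
    then show "X \<noteq> {}" "X \<subseteq> verts G" "CN G X \<noteq> {}" "CN2 G X = X"
      using s CN_subset[of G] by (auto simp: lovasz_complex_iff)
  next
    have "CN G A \<subseteq> CN G B \<or> CN G B \<subseteq> CN G A" if "A \<in> \<sigma>" "B \<in> \<sigma>" for A B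
      using s that CN_antimono[of A B G] CN_antimono[of B A G]
      unfolding lovasz_complex_iff chain_subset_def by meson
    then show "chain\<^sub>\<subseteq> (CN G ` \<sigma>)" unfolding chain_subset_def by blast
  qed
qed

lemma CN_neq: "A \<noteq> {} \<Longrightarrow> A \<subseteq> verts G \<Longrightarrow> CN G A \<noteq> A"
  using adj_not_same by (auto simp: CN_def)

lemma is_complex_ssd: "is_complex (ssd K)"
  unfolding is_complex_def
proof (intro ballI conjI allI impI)
  fix \<sigma> assume "\<sigma> \<in> ssd K"
  then obtain \<rho> \<A> \<B> where s: "\<rho> \<in> K" "\<sigma> = \<A> <+> \<B>"
    "\<A> \<in> sd (Pow (Inl -` \<rho>))" "\<B> \<in> sd (Pow (Inr -` \<rho>))"
    by (auto simp: ssd_def join_def)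
  then show "finite \<sigma>" by (simp add: sd_def)
  fix \<tau> assume \<tau>: "\<tau> \<subseteq> \<sigma>"
  have eq: "\<tau> = Inl -` \<tau> <+> Inr -` \<tau>"
  proof (rule set_eqI)
    fix x show "x \<in> \<tau> \<longleftrightarrow> x \<in> Inl -` \<tau> <+> Inr -` \<tau>" by (cases x) auto
  qed
  have sub: "\<C> \<in> sd L" if "\<C> \<subseteq> \<D>" "\<D> \<in> sd L" for \<C> \<D> and L :: "'c complex"
  proof -
    have "finite \<C>" using that finite_subset by (auto simp: sd_def)
    then show ?thesis using that unfolding sd_def chain_subset_def by (simp add: subset_iff)
  qed
  have "Inl -` \<tau> \<subseteq> \<A>" "Inr -` \<tau> \<subseteq> \<B>" using \<tau> s(2) by auto
  then have "Inl -` \<tau> \<in> sd (Pow (Inl -` \<rho>))" "Inr -` \<tau> \<in> sd (Pow (Inr -` \<rho>))"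
    using sub s(3,4) by metis+
  then have "\<tau> \<in> join (sd (Pow (Inl -` \<rho>))) (sd (Pow (Inr -` \<rho>)))"
    unfolding join_def using eq by blast
  then show "\<tau> \<in> ssd K" unfolding ssd_def by (rule UN_I[OF s(1)])
qed

lemma is_complex_image: "is_complex K \<Longrightarrow> is_complex (image_complex f K)"
  unfolding is_complex_def image_complex_def
proof (intro ballI conjI allI impI)
  assume K: "\<forall>\<sigma>\<in>K. finite \<sigma> \<and> (\<forall>\<tau>\<subseteq>\<sigma>. \<tau> \<in> K)"
  fix \<sigma>' assume "\<sigma>' \<in> {f ` \<sigma> | \<sigma>. \<sigma> \<in> K}"
  then obtain \<sigma> where s: "\<sigma>' = f ` \<sigma>" "\<sigma> \<in> K" by blast
  then show "finite \<sigma>'" using K by simp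
  fix \<tau>' assume "\<tau>' \<subseteq> \<sigma>'"
  then obtain \<tau> where "\<tau> \<subseteq> \<sigma>" "\<tau>' = f ` \<tau>" unfolding s(1) subset_image_iff by blast
  then show "\<tau>' \<in> {f ` \<sigma> | \<sigma>. \<sigma> \<in> K}" using K s(2) by blast
qed

lemma is_complex_halved_doubled_lovasz: "is_complex (halved_doubled_lovasz_complex G r)"
  unfolding halved_doubled_lovasz_complex_def doubled_lovasz_complex_def
  by (intro is_complex_image is_complex_ssd)

lemma halving_map_swap_shores:
  assumes lin: "linear_order_on (verts G) r" and ne: "verts G \<noteq> {}"
    and v: "v \<in> \<Union>(doubled_lovasz_complex G)"
  shows "halving_map G r (swap_shores v) = swap_shores (halving_map G r v)"
proof -
  have "pair_min G r (CN G A) = swap_shores (pair_min G r A)"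
    if "A \<noteq> {}" "A \<subseteq> verts G" "CN2 G A = A" for A
    using set_prec_asym_total[OF lin, of A "CN G A"] CN_neq[of A] that CN_subset[of G A]
      finite_subset[OF _ finite_verts]
    by (auto simp: pair_min_def)
  note pair_min_CN = this
  obtain \<A> \<B> where "v \<in> \<A> <+> \<B>" and L: "\<A> \<in> lovasz_complex G" "\<B> \<in> lovasz_complex G"
    using v unfolding doubled_lovasz_complex_eq[OF ne] by blast
  then consider A where "v = Inl A" "A \<in> \<A>" | A where "v = Inr A" "A \<in> \<B>" by blast
  then show ?thesis
  proof cases
    case 1
    then have "A \<noteq> {}" "A \<subseteq> verts G" "CN2 G A = A"
      using L unfolding lovasz_complex_iff by simp_all
    then show ?thesis using 1(1) pair_min_CN[of A] by simp
  next
    case 2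
    then have A: "A \<noteq> {}" "A \<subseteq> verts G" "CN G A \<noteq> {}" "CN2 G A = A"
      using L unfolding lovasz_complex_iff by simp_all
    then show ?thesis using 2(1) pair_min_CN[of "CN G A"] CN_subset[of G A] by simp
  qed
qed

lemma Z2_action_halved_doubled_lovasz:
  assumes lin: "linear_order_on (verts G) r" and ne: "verts G \<noteq> {}"
  shows "Z2_action (halved_doubled_lovasz_complex G r) swap_shores"
  unfolding Z2_action_def
proof (intro conjI ballI)
  fix v :: "'a set + 'a set"
  show "swap_shores (swap_shores v) = v" by (cases v) simp_all
next
  fix \<sigma> assume "\<sigma> \<in> halved_doubled_lovasz_complex G r"
  then obtain \<rho> where r: "\<rho> \<in> doubled_lovasz_complex G" "\<sigma> = halving_map G r ` \<rho>"
    unfolding halved_doubled_lovasz_complex_def image_complex_def by blast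
  then obtain \<A> \<B> where AB: "\<rho> = \<A> <+> \<B>" "\<A> \<in> lovasz_complex G" "\<B> \<in> lovasz_complex G"
    "\<forall>A\<in>\<A>. \<forall>B\<in>\<B>. \<forall>a\<in>A. \<forall>b\<in>B. a \<rightarrow>\<^bsub>G\<^esub> b"
    unfolding doubled_lovasz_complex_eq[OF ne] by blast
  have "\<forall>B\<in>\<B>. \<forall>A\<in>\<A>. \<forall>b\<in>B. \<forall>a\<in>A. b \<rightarrow>\<^bsub>G\<^esub> a"
    using AB(4) graph_symmetric by blast
  then have "\<B> <+> \<A> \<in> doubled_lovasz_complex G"
    unfolding doubled_lovasz_complex_eq[OF ne] using AB(2,3) by blast
  moreover have "swap_shores ` \<sigma> = halving_map G r ` (\<B> <+> \<A>)"
  proof -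
    have "swap_shores ` \<sigma> = halving_map G r ` swap_shores ` \<rho>"
      unfolding r(2) image_image
      using halving_map_swap_shores[OF lin ne UnionI[OF r(1)]] by (intro image_cong refl) simp
    then show ?thesis unfolding AB(1) swap_shores_Plus .
  qed
  ultimately show "swap_shores ` \<sigma> \<in> halved_doubled_lovasz_complex G r"
    unfolding halved_doubled_lovasz_complex_def image_complex_def by blast
qed

end

end

theory Submission
  imports Defs
begin

text \<open>If every set of \<open>\<A>\<close> is completely joined to every set of \<open>\<B>\<close>, then \<open>A \<subseteq> CN(B)\<close> for all
  \<open>A \<in> \<A>\<close>, \<open>B \<in> \<B>\<close>, so \<open>\<A> \<union> CN(\<B>)\<close> is again a chain, and the halving map has the same image on
  \<open>\<A> \<uplus> \<B>\<close> as on \<open>(\<A> \<union> CN(\<B>)) \<uplus> \<emptyset>\<close>. Hence the halved complex is the image of the Lovasz complex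
  under \<open>A \<mapsto> min {A \<uplus> \<emptyset>, \<emptyset> \<uplus> CN(A)}\<close>, which is injective because either element of the pair
  determines \<open>A = CN\<^sup>2(A)\<close>.\<close>

text \<open>Only reflecting simplices needs injectivity: if \<open>f\<close>
  \<sigma>\<open>equals\<close>f \<open>\<rho>\<close> for a simplex \<rho>, then \<sigma> = \<rho>,
  both being sets of vertices of \<open>K\<close>.\<close>

lemma simplicial_iso_image_complex:
  assumes inj: "inj_on f (\<Union>K)"
  shows "simplicial_iso K (image_complex f K) f"
proof -
  have "f ` \<Union>K = \<Union>(image_complex f K)"
    by (auto simp: image_complex_def)
  moreover have "\<sigma> \<in> K" if \<sigma>: "\<sigma> \<subseteq> \<Union>K" "f ` \<sigma> \<in> image_complex f K" for \<sigma>
  proof -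
    obtain \<rho> where \<rho>: "f ` \<sigma> = f ` \<rho>" "\<rho> \<in> K"
      using \<sigma>(2) by (auto simp: image_complex_def)
    then show ?thesis
      using inj_on_image_eq_iff[OF inj \<sigma>(1), of \<rho>] by blast
  qed
  moreover have "f ` \<sigma> \<in> image_complex f K" if "\<sigma> \<in> K" for \<sigma>
    using that by (auto simp: image_complex_def)
  ultimately show ?thesis
    using inj unfolding simplicial_iso_def bij_betw_def by blast
qed

lemma chain_subset_Un:
  assumes "chain\<^sub>\<subseteq> \<A>" "chain\<^sub>\<subseteq> \<B>" "\<forall>A\<in>\<A>. \<forall>B\<in>\<B>. A \<subseteq> B"
  shows "chain\<^sub>\<subseteq> (\<A> \<union> \<B>)"
  using assms unfolding chain_subset_def by (simp add: ball_Un)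

context graph
begin

text \<open>With an empty second shore the adjacency condition is vacuous, so the Lovasz complex
  embeds as the first shore.\<close>

lemma doubled_lovasz_complex_left:
  assumes "verts G \<noteq> {}" "\<C> \<in> lovasz_complex G"
  shows "\<C> <+> {} \<in> doubled_lovasz_complex G"
proof -
  have "{} \<in> lovasz_complex G"
    by (simp add: lovasz_complex_iff chain_subset_def)
  then show ?thesis
    using assms by (auto simp: doubled_lovasz_complex_eq)
qed

text \<open>Adjacency puts every member of \<A> below every \<open>CN G B\<close>, so the two chains
  stack into one; the sets \<open>CN G B\<close> are fixed by \<open>CN2\<close> since
  \<open>CN\<close> acts on the Lovasz complex.\<close>

lemma lovasz_complex_Un_CN:
  assumes A: "\<A> \<in> lovasz_complex G" and B: "\<B> \<in> lovasz_complex G"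
    and adj: "\<forall>A\<in>\<A>. \<forall>B\<in>\<B>. \<forall>a\<in>A. \<forall>b\<in>B. a \<rightarrow>\<^bsub>G\<^esub> b"
  shows "\<A> \<union> CN G ` \<B> \<in> lovasz_complex G"
proof -
  have "CN G ` \<B> \<in> lovasz_complex G"
    using Z2_action_lovasz B by (simp add: Z2_action_def)
  moreover have "A \<subseteq> CN G B" if "A \<in> \<A>" "B \<in> \<B>" for A B
  proof
    fix a assume "a \<in> A"
    moreover from this have "a \<in> verts G"
      using A that(1) unfolding lovasz_complex_iff by blast
    ultimately show "a \<in> CN G B"
      using adj that by (simp add: CN_def)
  qed
  then have "\<forall>A\<in>\<A>. \<forall>B\<in>CN G ` \<B>. A \<subseteq> B"
    by simp
  ultimately show ?thesis
    using A unfolding lovasz_complex_iff ball_Un by (intro conjI chain_subset_Un) simp_all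
qed

lemma halving_map_image_Plus:
  "halving_map G r ` (\<A> <+> \<B>) = pair_min G r ` (\<A> \<union> CN G ` \<B>)"
  by (simp add: Plus_def image_Un image_image)

lemma halved_doubled_lovasz_complex_eq:
  assumes ne: "verts G \<noteq> {}"
  shows "halved_doubled_lovasz_complex G r = image_complex (pair_min G r) (lovasz_complex G)"
proof (intro equalityI subsetI)
  fix \<sigma> assume "\<sigma> \<in> halved_doubled_lovasz_complex G r"
  then obtain \<rho> where \<sigma>: "\<sigma> = halving_map G r ` \<rho>" and "\<rho> \<in> doubled_lovasz_complex G"
    unfolding halved_doubled_lovasz_complex_def image_complex_def by blast
  then obtain \<A> \<B> where \<rho>: "\<rho> = \<A> <+> \<B>"
    and "\<A> \<in> lovasz_complex G" "\<B> \<in> lovasz_complex G"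
      "\<forall>A\<in>\<A>. \<forall>B\<in>\<B>. \<forall>a\<in>A. \<forall>b\<in>B. a \<rightarrow>\<^bsub>G\<^esub> b"
    unfolding doubled_lovasz_complex_eq[OF ne] by blast
  then show "\<sigma> \<in> image_complex (pair_min G r) (lovasz_complex G)"
    unfolding image_complex_def \<sigma> \<rho> halving_map_image_Plus
    by (blast intro: lovasz_complex_Un_CN)
next
  fix \<sigma> assume "\<sigma> \<in> image_complex (pair_min G r) (lovasz_complex G)"
  then obtain \<C> where \<C>: "\<sigma> = pair_min G r ` \<C>" "\<C> \<in> lovasz_complex G"
    by (auto simp: image_complex_def)
  then have "\<sigma> = halving_map G r ` (\<C> <+> {})"
    by (simp add: halving_map_image_Plus)
  then show "\<sigma> \<in> halved_doubled_lovasz_complex G r"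
    unfolding halved_doubled_lovasz_complex_def image_complex_def
    using doubled_lovasz_complex_left[OF ne \<C>(2)] by blast
qed

lemma inj_on_pair_min: "inj_on (pair_min G r) (\<Union>(lovasz_complex G))"
  \<comment> \<open>The left inverse reads \<open>A\<close> off \<open>Inl A\<close> and turns
    \<open>Inr (CN G A)\<close> into \<open>CN2 G A\<close>, which is \<open>A\<close> on
    vertices.\<close>
  by (rule inj_on_inverseI[of _ "case_sum id (CN G)"])
    (auto simp: pair_min_def lovasz_complex_def)

text \<open>This is equivariance of the halving map at \<open>Inl A\<close>: the swapped vertex
  \<open>Inr A\<close> belongs to the pair of \<open>CN G A\<close>.\<close>

lemma pair_min_CN:
  assumes "linear_order_on (verts G) r" and ne: "verts G \<noteq> {}" and A: "A \<in> \<Union>(lovasz_complex G)"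
  shows "pair_min G r (CN G A) = swap_shores (pair_min G r A)"
proof -
  have "Inl A \<in> \<Union>(doubled_lovasz_complex G)"
    using A doubled_lovasz_complex_left[OF ne] by blast
  then show ?thesis
    using halving_map_swap_shores[OF assms(1) ne, of "Inl A"] by simp
qed

end

theorem theorem2:
  fixes G :: "('a, 'b) pre_digraph" and r :: "'a rel"
  assumes "graph G" and "connected G"
    and "linear_order_on (verts G) r"
  shows "Z2_isomorphic (lovasz_complex G) (CN G)
           (halved_doubled_lovasz_complex G r) swap_shores"
proof -
  interpret graph G by fact
  have ne: "verts G \<noteq> {}"
    using assms(2) by (rule connected_nonempty)
  show ?thesis
    unfolding Z2_isomorphic_def halved_doubled_lovasz_complex_eq[OF ne]
    by (intro exI[of _ "pair_min G r"] conjI ballI simplicial_iso_image_complex inj_on_pair_min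
        pair_min_CN[OF assms(3) ne])
qed

end
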